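(* For any fixed integers $r>k\ge 2$, $$\frac{1}{r^k-r}\le\liminf_{n\to\infty}\frac{f_r(n,3r-2k,3)}{n^k}\le\limsup_{n\to\infty}\frac{f_r(n,3r-2k,3)}{n^k}\le \frac{1}{k!\binom{r}{k}-\frac{k!}{2}}.$$
   Context: An $r$-uniform hypergraph ($r$-graph) on a vertex set $V$ is a family of distinct $r$-element subsets of $V$, called edges. For integers $r\ge 2$, $e\ge 2$, $v\ge r+1$, an $r$-graph is called $\mathscr{G}_r(v,e)$-free if the union of any $e$ distinct edges of it contains at least $v+1$ vertices. $f_r(n,v,e)$ denotes the maximum number of edges in a $\mathscr{G}_r(v,e)$-free $r$-graph on $n$ vertices. *)

theory Defs
  imports Complex_Main "HOL-Library.Ramsey" "HOL-Library.Extended_Real"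
begin

(* Recall that nsets V r is the set of all finite subsets of V with exactly r elements. *)

definition r_graph :: "nat \<Rightarrow> 'a set \<Rightarrow> 'a set set \<Rightarrow> bool"
  where "r_graph r V E \<longleftrightarrow> E \<subseteq> nsets V r"

definition sparse_free :: "nat \<Rightarrow> nat \<Rightarrow> 'a set set \<Rightarrow> bool"
  where "sparse_free v e E \<longleftrightarrow> (\<forall>F \<in> nsets E e. card (\<Union>F) \<ge> v + 1)"

(* The number f_r(n,v,e), with {..<n} as the set of n vertices. *)

definition max_edges :: "nat \<Rightarrow> nat \<Rightarrow> nat \<Rightarrow> nat \<Rightarrow> nat"
  where "max_edges r n v e = Max {card E | E. r_graph r {..<n} E \<and> sparse_free v e E}"

end

(* Upper bound. Only O(n^(k-1)) edges meet another edge in more than k vertices, because a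
   (k-1)-subset of such an edge lies in at most two such edges. Among the remaining edges every
   k-set lies in at most two edges, and every edge contains at most one k-set of degree two.
   Counting pairs (edge, k-subset) gives |E| (binom(r,k) - 1/2) <= binom(n,k).

   Lower bound. Take a generic integer r x k matrix G and m congruent to 1 modulo a suitable D.
   The words (G x mod m), x in (Z/m)^k, are m^k transversal edges of an r-partite r-graph with
   parts of size m: two words agree in fewer than k positions, and the agreements of three words
   are controlled by 2k x 2k determinants that are units modulo m. Placing a copy of a good
   r-graph on m vertices into each part preserves the required sparsity, so that the extremal
   number g satisfies g(rm) >= m^k + r g(m), and the density converges to the solution
   c = 1/(r^k - r) of c = (1 + r c)/r^k. *)

theory Submission
  imports Defs "Jordan_Normal_Form.Determinant"
begin

section \<open>Upper bound on the number of edges\<close>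

lemma sparse_free_3D:
  assumes "sparse_free v 3 E" and "a \<in> E" "b \<in> E" "c \<in> E" and "a \<noteq> b" "b \<noteq> c" "a \<noteq> c"
  shows "v < card (a \<union> b \<union> c)"
proof -
  have "{a, b, c} \<in> nsets E 3"
    using assms by (simp add: nsets_def)
  with assms(1) have "v + 1 \<le> card (\<Union>{a, b, c})"
    unfolding sparse_free_def by blast
  then show ?thesis by (simp add: Un_assoc)
qed

lemma card_Un_le_if_common_subset:
  assumes "finite a" "finite b" and "S \<subseteq> a \<inter> b"
  shows "card (a \<union> b) + card S \<le> card a + card b"
  using assms card_mono[of "a \<inter> b" S] card_Un_Int[of a b] by fastforce

text \<open>If \<open>e\<close> and \<open>f\<close> share at least \<open>k + 1\<close> points and
  a third edge \<open>g\<close> shares a \<open>(k - 1)\<close>-set with \<open>e\<close>, the three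
  edges span at most \<open>(2 * r - (k + 1)) + (r - (k - 1)) = 3 * r - 2 * k\<close> points, which
  is forbidden. Hence choosing a \<open>(k - 1)\<close>-subset of each such edge is a map that is at
  most two-to-one.\<close>

lemma card_edges_with_large_intersection:
  assumes V: "finite V" and E: "r_graph r V E" "sparse_free (3 * r - 2 * k) 3 E"
    and k: "1 \<le> k" "k < r"
  shows "card {e \<in> E. \<exists>f\<in>E. f \<noteq> e \<and> k < card (e \<inter> f)} \<le> 2 * (card V choose (k - 1))"
proof -
  define B where "B = {e \<in> E. \<exists>f\<in>E. f \<noteq> e \<and> k < card (e \<inter> f)}"
  have edge: "e \<subseteq> V" "finite e" "card e = r" if "e \<in> E" for e
    using that E(1) by (auto simp: r_graph_def nsets_def)
  have "\<exists>S. S \<subseteq> e \<and> card S = k - 1" if "e \<in> B" for e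
    using that edge[of e] k by (metis (no_types, lifting) B_def diff_le_self le_trans less_imp_le
        mem_Collect_eq obtain_subset_with_card_n)
  then obtain \<sigma> where \<sigma>: "\<And>e. e \<in> B \<Longrightarrow> \<sigma> e \<subseteq> e \<and> card (\<sigma> e) = k - 1"
    by metis
  have im: "\<sigma> ` B \<subseteq> nsets V (k - 1)"
  proof
    fix S assume "S \<in> \<sigma> ` B"
    then obtain e where e: "e \<in> B" "S = \<sigma> e" by blast
    then have "e \<in> E" by (simp add: B_def)
    from edge[OF this] \<sigma>[OF e(1)] e(2) V show "S \<in> nsets V (k - 1)"
      by (auto simp: nsets_def intro: finite_subset)
  qed
  have fibre: "card {e \<in> B. \<sigma> e = S} \<le> 2" for S
  proof (cases "{e \<in> B. \<sigma> e = S} = {}")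
    case False
    then obtain e where e: "e \<in> B" "\<sigma> e = S" by blast
    then obtain f where f: "f \<in> E" "f \<noteq> e" "k < card (e \<inter> f)" "e \<in> E"
      by (auto simp: B_def)
    have "g = e \<or> g = f" if g: "g \<in> B" "\<sigma> g = S" for g
    proof (rule ccontr)
      assume neq: "\<not> (g = e \<or> g = f)"
      have gE: "g \<in> E" using g by (simp add: B_def)
      have "3 * r - 2 * k < card (e \<union> f \<union> g)"
        using sparse_free_3D[OF E(2) f(4) f(1) gE] neq f(2) by auto
      moreover have "card (e \<union> f \<union> g) + (k - 1) \<le> card (e \<union> f) + r"
        using card_Un_le_if_common_subset[of "e \<union> f" g S] edge[OF f(1)] edge[OF f(4)] edge[OF gE]
          \<sigma>[OF e(1)] \<sigma>[OF g(1)] e(2) g(2) by force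
      moreover have "card (e \<union> f) + card (e \<inter> f) = 2 * r"
        using edge[OF f(1)] edge[OF f(4)] card_Un_Int[of e f] by simp
      ultimately show False using f(3) k by linarith
    qed
    then have "{e \<in> B. \<sigma> e = S} \<subseteq> {e, f}" by blast
    then have "card {e \<in> B. \<sigma> e = S} \<le> card {e, f}" by (intro card_mono) auto
    also have "\<dots> \<le> 2" by (simp add: card_insert_if)
    finally show ?thesis .
  next
    case True
    then show ?thesis by (metis card.empty zero_le)
  qed
  have "card B \<le> (\<Sum>S\<in>nsets V (k - 1). card {e \<in> B. \<sigma> e = S})"
  proof -
    have "B = (\<Union>S\<in>nsets V (k - 1). {e \<in> B. \<sigma> e = S})" using im by blast
    then show ?thesis
      using card_UN_le[OF finite_imp_finite_nsets[OF V, of "k - 1"], of "\<lambda>S. {e \<in> B. \<sigma> e = S}"]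
      by simp
  qed
  also have "\<dots> \<le> (\<Sum>S\<in>nsets V (k - 1). 2)"
    by (intro sum_mono fibre)
  also have "\<dots> = 2 * (card V choose (k - 1))"
    using V by (simp add: card_nsets)
  finally show ?thesis unfolding B_def .
qed

text \<open>Double counting of pairs of an edge and a \<open>k\<close>-subset of it. A
  \<open>k\<close>-set has degree at most two, and every edge contains at most one
  \<open>k\<close>-set of degree two, so there are at most \<open>card E / 2\<close> of these. The
  inequality is doubled to stay within the natural numbers.\<close>

lemma card_edges_with_small_intersections:
  assumes V: "finite V" and E: "r_graph r V E" "sparse_free (3 * r - 2 * k) 3 E"
    and small: "\<And>e f. e \<in> E \<Longrightarrow> f \<in> E \<Longrightarrow> e \<noteq> f \<Longrightarrow> card (e \<inter> f) \<le> k" and k: "k < r"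
  shows "2 * (r choose k) * card E \<le> 2 * (card V choose k) + card E"
proof -
  define d where "d = (\<lambda>K. card {e \<in> E. K \<subseteq> e})"
  define X where "X = nsets V k"
  define Y where "Y = {K \<in> X. d K = 2}"
  have edge: "e \<subseteq> V" "finite e" "card e = r" if "e \<in> E" for e
    using that E(1) by (auto simp: r_graph_def nsets_def)
  have finE: "finite E"
    using V E(1) unfolding r_graph_def by (meson finite_imp_finite_nsets finite_subset)
  have finX: "finite X" "finite Y"
    using V by (auto simp: X_def Y_def finite_imp_finite_nsets)
  have double_count: "(\<Sum>K\<in>Z. d K) = (\<Sum>e\<in>E. card {K \<in> Z. K \<subseteq> e})" if "finite Z" for Z
    unfolding d_def using that finE by (intro sum_multicount_gen) auto
  \<comment> \<open>Three edges through a common \<open>k\<close>-set span at most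
    \<open>r + 2 * (r - k)\<close> points.\<close>
  have d_le: "d K \<le> 2" if "K \<in> X" for K
  proof (rule ccontr)
    assume "\<not> d K \<le> 2"
    then have "3 \<le> card {e \<in> E. K \<subseteq> e}" by (simp add: d_def)
    then obtain F where "F \<subseteq> {e \<in> E. K \<subseteq> e}" "card F = 3"
      by (meson obtain_subset_with_card_n)
    moreover from this obtain a b c where "F = {a, b, c}" "a \<noteq> b" "b \<noteq> c" "a \<noteq> c"
      unfolding card_3_iff by blast
    ultimately have abc: "a \<in> E" "b \<in> E" "c \<in> E" "a \<noteq> b" "b \<noteq> c" "a \<noteq> c"
        "K \<subseteq> a" "K \<subseteq> b" "K \<subseteq> c"
      by simp_all
    have "3 * r - 2 * k < card (a \<union> b \<union> c)"
      using sparse_free_3D[OF E(2)] abc by blast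
    moreover have "card (a \<union> b \<union> c) + k \<le> card (a \<union> b) + r" "card (a \<union> b) + k \<le> r + r"
      using card_Un_le_if_common_subset[of "a \<union> b" c K] card_Un_le_if_common_subset[of a b K]
        edge[OF abc(1)] edge[OF abc(2)] edge[OF abc(3)] abc that by (auto simp: X_def nsets_def)
    ultimately show False by linarith
  qed
  text \<open>An edge meeting two others in different \<open>k\<close>-sets would give a forbidden triple.\<close>
  have Y_le: "card {K \<in> Y. K \<subseteq> e} \<le> 1" if e: "e \<in> E" for e
  proof -
    \<comment> \<open>Degree two supplies a second edge through \<open>K\<close>. By
      \<open>small\<close> it meets \<open>e\<close> in at most \<open>card K\<close> points, hence
      exactly in \<open>K\<close>; so different sets \<open>K\<close> come from different
      partners.\<close>
    have partner: "\<exists>f\<in>E. f \<noteq> e \<and> e \<inter> f = K" if K: "K \<in> Y" "K \<subseteq> e" for K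
    proof -
      have "card {e \<in> E. K \<subseteq> e} = 2" using K by (simp add: Y_def d_def)
      then obtain f where f: "f \<in> E" "K \<subseteq> f" "f \<noteq> e"
        using K e by (metis (mono_tags, lifting) card_2_iff' mem_Collect_eq)
      moreover have "card K = k" using K by (simp add: Y_def X_def nsets_def)
      ultimately have "K = e \<inter> f"
        using small[OF e f(1)] K edge[OF e] by (intro card_seteq) auto
      with f show ?thesis by blast
    qed
    have "K = K'" if K: "K \<in> Y" "K \<subseteq> e" and K': "K' \<in> Y" "K' \<subseteq> e" for K K'
    proof (rule ccontr)
      assume "K \<noteq> K'"
      obtain f where f: "f \<in> E" "f \<noteq> e" "e \<inter> f = K" using partner[OF K] by blast
      obtain g where g: "g \<in> E" "g \<noteq> e" "e \<inter> g = K'" using partner[OF K'] by blast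
      have cards: "card K = k" "card K' = k" using K K' by (auto simp: Y_def X_def nsets_def)
      have "3 * r - 2 * k < card (e \<union> f \<union> g)"
        using sparse_free_3D[OF E(2) e f(1) g(1)] f g \<open>K \<noteq> K'\<close> by auto
      moreover have "card (e \<union> f \<union> g) + k \<le> card (e \<union> f) + r" "card (e \<union> f) + k \<le> r + r"
        using card_Un_le_if_common_subset[of "e \<union> f" g K'] card_Un_le_if_common_subset[of e f K]
          edge[OF e] edge[OF f(1)] edge[OF g(1)] f g cards by auto
      ultimately show False by linarith
    qed
    then show ?thesis
      using finX by (auto simp: card_le_Suc0_iff_eq)
  qed
  have "2 * card Y = (\<Sum>K\<in>Y. d K)" by (simp add: Y_def)
  also have "\<dots> = (\<Sum>e\<in>E. card {K \<in> Y. K \<subseteq> e})" using finX by (intro double_count)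
  also have "\<dots> \<le> (\<Sum>e\<in>E. 1)" by (intro sum_mono Y_le)
  finally have Y: "2 * card Y \<le> card E" by simp
  have "(r choose k) * card E = (\<Sum>e\<in>E. card {K \<in> X. K \<subseteq> e})"
  proof -
    have "card {K \<in> X. K \<subseteq> e} = r choose k" if "e \<in> E" for e
    proof -
      have "{K \<in> X. K \<subseteq> e} = nsets e k"
        using edge[OF that] by (auto simp: X_def nsets_def)
      then show ?thesis using edge[OF that] by (simp add: card_nsets)
    qed
    then show ?thesis by simp
  qed
  also have "\<dots> = (\<Sum>K\<in>X. d K)" using finX by (intro double_count[symmetric])
  also have "\<dots> \<le> (\<Sum>K\<in>X. 1 + (if d K = 2 then 1 else 0))"
    using d_le by (intro sum_mono) (force simp: le_Suc_eq numeral_2_eq_2)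
  also have "\<dots> = card X + card Y"
    unfolding sum.distrib using finX by (simp add: sum.If_cases Y_def Int_def)
  finally show ?thesis
    using Y V by (simp add: X_def card_nsets)
qed

text \<open>Deleting the edges with a large intersection leaves a hypergraph to which the double
  count applies. The subtracted term bounds the number of deleted edges.\<close>

lemma card_sparse_free_le:
  assumes V: "finite V" and E: "r_graph r V E" "sparse_free (3 * r - 2 * k) 3 E"
    and k: "1 \<le> k" "k < r"
  shows "(real (r choose k) - 1 / 2) * (real (card E) - 2 * real (card V choose (k - 1)))
    \<le> real (card V choose k)"
proof -
  define B where "B = {e \<in> E. \<exists>f\<in>E. f \<noteq> e \<and> k < card (e \<inter> f)}"
  have "r_graph r V (E - B)" "sparse_free (3 * r - 2 * k) 3 (E - B)"
    using E nsets_mono[of "E - B" E 3] by (auto simp: r_graph_def sparse_free_def)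
  then have "2 * (r choose k) * card (E - B) \<le> 2 * (card V choose k) + card (E - B)"
    using V k by (intro card_edges_with_small_intersections) (auto simp: B_def not_less)
  then have "real (2 * (r choose k) * card (E - B)) \<le> real (2 * (card V choose k) + card (E - B))"
    by (simp only: of_nat_le_iff)
  then have *: "(real (r choose k) - 1 / 2) * card (E - B) \<le> real (card V choose k)"
    by (simp add: algebra_simps)
  have "card E \<le> card B + card (E - B)"
  proof -
    have "E = B \<union> (E - B)" by (auto simp: B_def)
    then show ?thesis by (metis card_Un_le)
  qed
  moreover have "card B \<le> 2 * (card V choose (k - 1))"
    unfolding B_def using assms by (rule card_edges_with_large_intersection)
  ultimately have "card E \<le> 2 * (card V choose (k - 1)) + card (E - B)"
    by linarith
  then have "real (card E) \<le> real (2 * (card V choose (k - 1)) + card (E - B))"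
    by (simp only: of_nat_le_iff)
  then have "real (card E) - 2 * real (card V choose (k - 1)) \<le> card (E - B)"
    by simp
  moreover have "1 \<le> r choose k" using k by (simp add: Suc_leI)
  then have "0 \<le> real (r choose k) - 1 / 2" by linarith
  ultimately show ?thesis
    using * by (meson mult_left_mono order_trans)
qed

section \<open>Generic integer matrices modulo m\<close>

text \<open>Finitely many nonzero polynomial functions have a common point where none vanishes.
  Being polynomial is required only along lines, so univariate polynomials suffice: the line from a
  point \<open>G\<close> good for \<open>I\<close> to a point \<open>H\<close> good for
  \<open>c\<close> contains only finitely many bad parameters.\<close>

lemma common_nonvanishing_point:
  fixes f :: "'c \<Rightarrow> ('a \<Rightarrow> 'b \<Rightarrow> int) \<Rightarrow> int"
  assumes "finite I"
    and "\<And>c. c \<in> I \<Longrightarrow> \<exists>G. f c G \<noteq> 0"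
    and "\<And>c G H. c \<in> I \<Longrightarrow> \<exists>p. \<forall>t. f c (\<lambda>i j. G i j + t * H i j) = poly p t"
  shows "\<exists>G. \<forall>c\<in>I. f c G \<noteq> 0"
  using assms
proof (induction I rule: finite_induct)
  case empty
  then show ?case by simp
next
  case (insert c I)
  have "\<exists>G. \<forall>d\<in>I. f d G \<noteq> 0"
    by (rule insert.IH) (simp_all add: insert.prems)
  then obtain G where G: "\<And>d. d \<in> I \<Longrightarrow> f d G \<noteq> 0"
    by blast
  from insert.prems obtain H where H: "f c H \<noteq> 0" by blast
  let ?line = "\<lambda>t i j. G i j + t * (H i j - G i j)"
  have "\<forall>d\<in>insert c I. \<exists>p. \<forall>t. f d (?line t) = poly p t"
    using insert.prems(2)[of _ G "\<lambda>i j. H i j - G i j"] by blast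
  from bchoice[OF this] obtain p
    where p: "\<And>d t. d \<in> insert c I \<Longrightarrow> f d (?line t) = poly (p d) t"
    by blast
  have line: "?line 0 = G" "?line 1 = H" by auto
  \<comment> \<open>The restriction to the line is nonzero at \<open>t = 0\<close> for
    \<open>d\<close> in \<open>I\<close> and at \<open>t = 1\<close> for
    \<open>d = c\<close>.\<close>
  have "p d \<noteq> 0" if d: "d \<in> insert c I" for d
  proof
    assume "p d = 0"
    then have "f d G = 0" "f d H = 0"
      using p[OF d, of 0] p[OF d, of 1] unfolding line by simp_all
    with G H d show False by blast
  qed
  then have "finite (\<Union>d\<in>insert c I. {t. poly (p d) t = 0})"
    using insert.hyps by (auto intro: poly_roots_finite)
  then obtain t :: int where "t \<notin> (\<Union>d\<in>insert c I. {t. poly (p d) t = 0})"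
    using ex_new_if_finite infinite_UNIV_int by blast
  then show ?case
    using p by (intro exI[of _ "?line t"]) auto
qed

text \<open>The polynomial is the determinant of the matrix with linear polynomial entries;
  evaluation at \<open>t\<close> is a ring homomorphism and so commutes with
  \<open>det\<close>.\<close>

lemma det_entrywise_affine_poly:
  fixes A B :: "nat \<Rightarrow> nat \<Rightarrow> int"
  shows "\<exists>p. \<forall>t. det (mat N N (\<lambda>(l, j). A l j + t * B l j)) = poly p t"
proof (intro exI allI)
  fix t
  interpret comm_ring_hom "\<lambda>p :: int poly. poly p t"
    by unfold_locales auto
  have "mat N N (\<lambda>(l, j). A l j + t * B l j)
      = map_mat (\<lambda>p. poly p t) (mat N N (\<lambda>(l, j). [:A l j, B l j:]))"
    by (rule eq_matI) auto
  then show "det (mat N N (\<lambda>(l, j). A l j + t * B l j))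
      = poly (det (mat N N (\<lambda>(l, j). [:A l j, B l j:]))) t"
    by (simp add: hom_det)
qed

section \<open>Linear systems modulo \<open>m\<close> and their determinants\<close>

text \<open>Multiplying by the adjugate turns \<open>A *\<^sub>v x\<close> into \<open>det A\<close>
  times \<open>x\<close>, and \<open>det A\<close> is a unit modulo \<open>m\<close>. No primality
  of \<open>m\<close> enters.\<close>

lemma kernel_mod_coprime_det:
  fixes A :: "int mat"
  assumes A: "A \<in> carrier_mat N N" and x: "x \<in> carrier_vec N"
    and m: "coprime m (det A)" and dvd: "\<And>l. l < N \<Longrightarrow> m dvd (A *\<^sub>v x) $ l"
    and j: "j < N"
  shows "m dvd x $ j"
proof -
  note adj = adj_mat[OF A]
  have "adj_mat A *\<^sub>v (A *\<^sub>v x) = det A \<cdot>\<^sub>v x"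
  proof (rule eq_vecI)
    fix i assume "i < dim_vec (det A \<cdot>\<^sub>v x)"
    then have "i < N" using x by simp
    moreover have "adj_mat A *\<^sub>v (A *\<^sub>v x) = (det A \<cdot>\<^sub>m 1\<^sub>m N) *\<^sub>v x"
      using assoc_mult_mat_vec[OF adj(1) A x] adj(3) by simp
    ultimately show "(adj_mat A *\<^sub>v (A *\<^sub>v x)) $ i = (det A \<cdot>\<^sub>v x) $ i"
      using x by simp
  qed (use adj x in auto)
  then have "(det A \<cdot>\<^sub>v x) $ j = row (adj_mat A) j \<bullet> (A *\<^sub>v x)"
    using j adj(1) by (metis carrier_matD(1) index_mult_mat_vec)
  also have "\<dots> = (\<Sum>l<N. adj_mat A $$ (j, l) * (A *\<^sub>v x) $ l)"
    using j A adj(1) by (simp add: scalar_prod_def lessThan_atLeast0)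
  finally have "det A * x $ j = (\<Sum>l<N. adj_mat A $$ (j, l) * (A *\<^sub>v x) $ l)"
    using j x by simp
  also have "m dvd \<dots>"
    by (intro dvd_sum dvd_mult) (auto intro: dvd)
  finally show ?thesis
    using m by (simp add: coprime_dvd_mult_right_iff)
qed

text \<open>An entry \<open>(i, \<alpha>, \<beta>)\<close> of \<open>L\<close> stands for the linear constraint
  \<open>\<alpha> \<langle>G i, u\<rangle> + \<beta> \<langle>G i, v\<rangle> = 0\<close> on a pair \<open>(u, v)\<close> of vectors of length \<open>k\<close>.\<close>

definition constraint_mat :: "nat \<Rightarrow> (nat \<times> int \<times> int) list \<Rightarrow> (nat \<Rightarrow> nat \<Rightarrow> int) \<Rightarrow> int mat"
  where "constraint_mat k L G = mat (2 * k) (2 * k) (\<lambda>(l, j). case L ! l of (i, \<alpha>, \<beta>) \<Rightarrow>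
    if j < k then \<alpha> * G i j else \<beta> * G i (j - k))"

lemma sum_lessThan_double:
  fixes f :: "nat \<Rightarrow> 'a :: comm_monoid_add"
  shows "(\<Sum>j<2 * k. f j) = (\<Sum>j<k. f j) + (\<Sum>j<k. f (k + j))"
proof -
  have "(\<Sum>j<2 * k. f j) = sum f {0..<k} + sum f {0 + k..<k + k}"
    by (simp add: lessThan_atLeast0 mult_2 sum.atLeastLessThan_concat)
  then show ?thesis
    unfolding sum.shift_bounds_nat_ivl by (simp add: lessThan_atLeast0 add.commute)
qed

lemma constraint_mat_mult_vec:
  assumes "l < 2 * k" and "L ! l = (i, \<alpha>, \<beta>)"
  shows "(constraint_mat k L G *\<^sub>v vec (2 * k) (\<lambda>j. if j < k then u j else v (j - k))) $ l
    = (\<Sum>j<k. G i j * (\<alpha> * u j + \<beta> * v j))"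
  using assms
  by (simp add: constraint_mat_def scalar_prod_def lessThan_atLeast0[symmetric]
      sum_lessThan_double sum.distrib[symmetric]) (simp add: algebra_simps)

text \<open>A certificate that the determinant of the square constraint matrix is not identically
  zero in the entries of the matrix: for one special \<open>H\<close> the system has only the
  trivial integer solution. In this form it can be verified with explicit unit vectors, without
  computing a determinant.\<close>

definition nondegenerate :: "nat \<Rightarrow> (nat \<times> int \<times> int) list \<Rightarrow> bool"
  where "nondegenerate k L \<longleftrightarrow> length L = 2 * k \<and> (\<exists>H. \<forall>u v.
    (\<forall>(i, \<alpha>, \<beta>)\<in>set L. (\<Sum>j<k. H i j * (\<alpha> * u j + \<beta> * v j)) = 0) \<longrightarrow>
    (\<forall>j<k. u j = 0 \<and> v j = 0))"

text \<open>A singular integer matrix has a nonzero integer kernel vector; its two halves would be a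
  nontrivial solution \<open>(u, v)\<close>.\<close>

lemma nondegenerate_imp_det:
  assumes "nondegenerate k L"
  shows "\<exists>H. det (constraint_mat k L H) \<noteq> 0"
proof -
  obtain H where L: "length L = 2 * k" and H: "\<forall>u v.
      (\<forall>(i, \<alpha>, \<beta>)\<in>set L. (\<Sum>j<k. H i j * (\<alpha> * u j + \<beta> * v j)) = 0) \<longrightarrow>
      (\<forall>j<k. u j = 0 \<and> v j = 0)"
    using assms unfolding nondegenerate_def by (elim conjE exE) (rule that)
  have "det (constraint_mat k L H) \<noteq> 0"
  proof
    have carr: "constraint_mat k L H \<in> carrier_mat (2 * k) (2 * k)"
      by (simp add: constraint_mat_def)
    assume "det (constraint_mat k L H) = 0"
    then obtain x where x: "x \<in> carrier_vec (2 * k)" "x \<noteq> 0\<^sub>v (2 * k)"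
        "constraint_mat k L H *\<^sub>v x = 0\<^sub>v (2 * k)"
      using det_0_iff_vec_prod_zero[OF carr] by blast
    let ?u = "\<lambda>j. x $ j" and ?v = "\<lambda>j. x $ (k + j)"
    have x_eq: "x = vec (2 * k) (\<lambda>j. if j < k then ?u j else ?v (j - k))"
      using x(1) by (intro eq_vecI) auto
    have "\<forall>(i, \<alpha>, \<beta>)\<in>set L. (\<Sum>j<k. H i j * (\<alpha> * ?u j + \<beta> * ?v j)) = 0"
    proof clarify
      fix i \<alpha> \<beta> assume "(i, \<alpha>, \<beta>) \<in> set L"
      then obtain l where l: "l < 2 * k" "L ! l = (i, \<alpha>, \<beta>)"
        using L by (auto simp: in_set_conv_nth)
      show "(\<Sum>j<k. H i j * (\<alpha> * ?u j + \<beta> * ?v j)) = 0"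
        using constraint_mat_mult_vec[OF l, of H ?u ?v] x(3) l(1) x_eq by simp
    qed
    from H[THEN spec, THEN spec, THEN mp, OF this]
    have zero: "?u j = 0 \<and> ?v j = 0" if "j < k" for j
      using that by simp
    have "x = 0\<^sub>v (2 * k)"
    proof (rule eq_vecI)
      fix j assume "j < dim_vec (0\<^sub>v (2 * k) :: int vec)"
      then show "x $ j = 0\<^sub>v (2 * k) $ j"
        using zero[of j] zero[of "j - k"] by (cases "j < k") auto
    qed (use x in auto)
    with x(2) show False by simp
  qed
  then show ?thesis by blast
qed

text \<open>Only finitely many systems of length \<open>2 * k\<close> have rows from the finite set
  \<open>S\<close>, so one \<open>G\<close> makes all their determinants nonzero. With
  \<open>D\<close> the product of these determinants, each of them is a unit modulo every
  \<open>m\<close> coprime to \<open>D\<close>.\<close>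

lemma exists_generic_matrix:
  assumes "finite S"
  shows "\<exists>G D. D \<noteq> (0 :: int) \<and> (\<forall>L u v m. nondegenerate k L \<longrightarrow> set L \<subseteq> S \<longrightarrow> coprime m D \<longrightarrow>
    (\<forall>(i, \<alpha>, \<beta>)\<in>set L. m dvd (\<Sum>j<k. G i j * (\<alpha> * u j + \<beta> * v j))) \<longrightarrow>
    (\<forall>j<k. m dvd u j \<and> m dvd v j))"
proof -
  define I where "I = {L. set L \<subseteq> S \<and> length L = 2 * k \<and> nondegenerate k L}"
  have fin: "finite I"
    by (rule finite_subset[OF _ finite_lists_length_eq[OF assms, of "2 * k"]]) (auto simp: I_def)
  have "\<exists>G. \<forall>L\<in>I. det (constraint_mat k L G) \<noteq> 0"
  proof (rule common_nonvanishing_point[OF fin])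
    fix L G H assume "L \<in> I"
    define M :: "(nat \<Rightarrow> nat \<Rightarrow> int) \<Rightarrow> nat \<Rightarrow> nat \<Rightarrow> int"
      where "M = (\<lambda>G l j. case L ! l of (i, \<alpha>, \<beta>) \<Rightarrow>
        if j < k then \<alpha> * G i j else \<beta> * G i (j - k))"
    have "constraint_mat k L (\<lambda>i j. G i j + t * H i j)
        = mat (2 * k) (2 * k) (\<lambda>(l, j). M G l j + t * M H l j)" for t
      by (rule eq_matI) (auto simp: constraint_mat_def M_def algebra_simps split: prod.splits)
    then show "\<exists>p. \<forall>t. det (constraint_mat k L (\<lambda>i j. G i j + t * H i j)) = poly p t"
      using det_entrywise_affine_poly[of "2 * k" "M G" "M H"] by simp
  qed (auto simp: I_def nondegenerate_imp_det)
  then obtain G where G: "\<And>L. L \<in> I \<Longrightarrow> det (constraint_mat k L G) \<noteq> 0"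
    by blast
  define D where "D = (\<Prod>L\<in>I. det (constraint_mat k L G))"
  have "D \<noteq> 0"
    using fin G by (simp add: D_def)
  moreover have "m dvd u j \<and> m dvd v j"
    if L: "nondegenerate k L" "set L \<subseteq> S" and m: "coprime m D"
      and dvd: "\<forall>(i, \<alpha>, \<beta>)\<in>set L. m dvd (\<Sum>j<k. G i j * (\<alpha> * u j + \<beta> * v j))"
      and j: "j < k" for L u v m j
  proof -
    let ?A = "constraint_mat k L G"
    let ?x = "vec (2 * k) (\<lambda>j. if j < k then u j else v (j - k))"
    have len: "length L = 2 * k" using L by (simp add: nondegenerate_def)
    then have "L \<in> I" using L by (simp add: I_def)
    then have "coprime m (det ?A)"
      using m fin unfolding D_def by (meson coprime_divisors dvd_prodI dvd_refl)
    moreover have "m dvd (?A *\<^sub>v ?x) $ l" if l: "l < 2 * k" for l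
    proof -
      obtain i \<alpha> \<beta> where "L ! l = (i, \<alpha>, \<beta>)" by (cases "L ! l")
      moreover from this have "(i, \<alpha>, \<beta>) \<in> set L" using l len by (metis nth_mem)
      ultimately show ?thesis
        using dvd constraint_mat_mult_vec[OF l] by fastforce
    qed
    moreover have "?A \<in> carrier_mat (2 * k) (2 * k)" by (simp add: constraint_mat_def)
    ultimately have "m dvd ?x $ l" if "l < 2 * k" for l
      using that kernel_mod_coprime_det[of ?A "2 * k" ?x m l] by auto
    from this[of j] this[of "k + j"] j show ?thesis by simp
  qed
  ultimately show ?thesis by blast
qed

section \<open>Agreements of codewords\<close>

text \<open>The three row types say that \<open>u\<close>, \<open>v\<close> and \<open>u + v\<close>
  are orthogonal to row \<open>i\<close>. For \<open>u = x - y\<close> and \<open>v = y - z\<close>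
  they express agreement at position \<open>i\<close> of the words of \<open>x, y\<close>, of
  \<open>y, z\<close> and of \<open>x, z\<close>.\<close>

definition constraint_rows :: "nat set \<Rightarrow> nat set \<Rightarrow> nat set \<Rightarrow> (nat \<times> int \<times> int) list"
  where "constraint_rows A B C = map (\<lambda>i. (i, 1, 0)) (sorted_list_of_set A)
    @ map (\<lambda>i. (i, 0, 1)) (sorted_list_of_set B) @ map (\<lambda>i. (i, 1, 1)) (sorted_list_of_set C)"

lemma set_constraint_rows:
  assumes "finite A" "finite B" "finite C"
  shows "set (constraint_rows A B C)
    = (\<lambda>i. (i, 1, 0)) ` A \<union> (\<lambda>i. (i, 0, 1)) ` B \<union> (\<lambda>i. (i, 1, 1)) ` C"
  using assms by (simp add: constraint_rows_def Un_assoc)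

text \<open>Specialising row \<open>i\<close> of the matrix to the unit vector \<open>\<phi> i\<close>, two different constraint
  types on coordinate \<open>j\<close> force both \<open>u j\<close> and \<open>v j\<close> to vanish.\<close>

lemma nondegenerate_constraint_rows:
  assumes fin: "finite A" "finite B" "finite C" and card: "card A + card B + card C = 2 * k"
    and \<phi>: "\<And>j. j < k \<Longrightarrow> j \<in> (\<phi> ` A \<inter> \<phi> ` B) \<union> (\<phi> ` A \<inter> \<phi> ` C) \<union> (\<phi> ` B \<inter> \<phi> ` C)"
  shows "nondegenerate k (constraint_rows A B C)"
  unfolding nondegenerate_def
proof (intro conjI exI allI impI)
  show "length (constraint_rows A B C) = 2 * k"
    using card by (simp add: constraint_rows_def)
next
  fix u v :: "nat \<Rightarrow> int" and j
  let ?H = "\<lambda>i j. if j = \<phi> i then 1 else 0 :: int"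
  assume zero: "\<forall>(i, \<alpha>, \<beta>)\<in>set (constraint_rows A B C). (\<Sum>j<k. ?H i j * (\<alpha> * u j + \<beta> * v j)) = 0"
    and j: "j < k"
  have unit: "(\<Sum>j<k. ?H i j * f j) = f (\<phi> i)" if "\<phi> i < k" for i and f :: "nat \<Rightarrow> int"
  proof -
    have "?H i j * f j = (if \<phi> i = j then f j else 0)" for j by simp
    then show ?thesis using that by (simp add: sum.delta')
  qed
  have "\<alpha> * u (\<phi> i) + \<beta> * v (\<phi> i) = 0"
    if "(i, \<alpha>, \<beta>) \<in> set (constraint_rows A B C)" "\<phi> i < k" for i \<alpha> \<beta>
    using bspec[OF zero that(1)] that(2) unit[of i "\<lambda>j. \<alpha> * u j + \<beta> * v j"] by simp
  note row = this[unfolded set_constraint_rows[OF fin]]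
  have "u j = 0" if "j \<in> \<phi> ` A"
    using that row[of _ 1 0] j by (auto simp del: mult_eq_0_iff)
  moreover have "v j = 0" if "j \<in> \<phi> ` B"
    using that row[of _ 0 1] j by (auto simp del: mult_eq_0_iff)
  moreover have "u j + v j = 0" if "j \<in> \<phi> ` C"
    using that row[of _ 1 1] j by (auto simp del: mult_eq_0_iff)
  ultimately show "u j = 0" and "v j = 0" using \<phi>[OF j] by force+
qed

text \<open>Lay out \<open>A\<close>, \<open>B\<close>, \<open>C\<close> one after the other on the
  positions below \<open>2 * n\<close> and reduce modulo \<open>n\<close>. Each residue
  \<open>s\<close> is hit by the positions \<open>s\<close> and \<open>s + n\<close>, and these lie
  in different sets because each set fills an interval of length at most \<open>n\<close>.\<close>

lemma cyclic_double_cover: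
  assumes fin: "finite A" "finite B" "finite C" and disj: "A \<inter> B = {}" "A \<inter> C = {}" "B \<inter> C = {}"
    and le: "card A \<le> n" "card B \<le> n" "card C \<le> n" and sum: "card A + card B + card C = 2 * n"
  shows "\<exists>\<psi>. \<forall>s<n. s \<in> (\<psi> ` A \<inter> \<psi> ` B) \<union> (\<psi> ` A \<inter> \<psi> ` C) \<union> (\<psi> ` B \<inter> \<psi> ` C)"
proof -
  obtain f g h where f: "bij_betw f {0..<card A} A" and g: "bij_betw g {0..<card B} B"
    and h: "bij_betw h {0..<card C} C"
    using ex_bij_betw_nat_finite fin by metis
  define \<psi> where "\<psi> i = (if i \<in> A then inv_into {0..<card A} f i
    else if i \<in> B then card A + inv_into {0..<card B} g i
    else card A + card B + inv_into {0..<card C} h i) mod n" for i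
  have A: "p mod n \<in> \<psi> ` A" if "p < card A" for p
  proof -
    have "f p \<in> A" "inv_into {0..<card A} f (f p) = p"
      using f that by (auto simp: bij_betw_def)
    then have "\<psi> (f p) = p mod n" by (simp add: \<psi>_def)
    with \<open>f p \<in> A\<close> show ?thesis by (metis image_eqI)
  qed
  have B: "p mod n \<in> \<psi> ` B" if "card A \<le> p" "p < card A + card B" for p
  proof -
    let ?q = "p - card A"
    have "g ?q \<in> B" "inv_into {0..<card B} g (g ?q) = ?q"
      using g that by (auto simp: bij_betw_def)
    moreover from this have "g ?q \<notin> A" using disj by blast
    ultimately have "\<psi> (g ?q) = p mod n" using that by (simp add: \<psi>_def)
    with \<open>g ?q \<in> B\<close> show ?thesis by (metis image_eqI)
  qed
  have C: "p mod n \<in> \<psi> ` C" if "card A + card B \<le> p" "p < 2 * n" for p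
  proof -
    let ?q = "p - card A - card B"
    have "h ?q \<in> C" "inv_into {0..<card C} h (h ?q) = ?q"
      using h that sum by (auto simp: bij_betw_def)
    moreover from this have "h ?q \<notin> A" "h ?q \<notin> B" using disj by blast+
    ultimately have "\<psi> (h ?q) = p mod n" using that by (simp add: \<psi>_def)
    with \<open>h ?q \<in> C\<close> show ?thesis by (metis image_eqI)
  qed
  have "s \<in> (\<psi> ` A \<inter> \<psi> ` B) \<union> (\<psi> ` A \<inter> \<psi> ` C) \<union> (\<psi> ` B \<inter> \<psi> ` C)" if s: "s < n" for s
  proof -
    have "s mod n = s" "(s + n) mod n = s" using s by auto
    note pos = A[of s] B[of s] B[of "s + n"] C[of "s + n", unfolded this]
    \<comment> \<open>In turn: \<open>s + n\<close> lies beyond \<open>A\<close>, \<open>s\<close>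
      lies before \<open>C\<close>, and \<open>s\<close> and \<open>s + n\<close> are not both in
      \<open>B\<close>.\<close>
    have "card A \<le> s + n" "s < card A + card B" "s < card A \<or> card A + card B \<le> s + n"
      using le sum s by linarith+
    then show ?thesis
      using pos \<open>s mod n = s\<close> \<open>(s + n) mod n = s\<close> s
      by (cases "s < card A"; cases "s + n < card A + card B") auto
  qed
  then show ?thesis by blast
qed

section \<open>Zero sets of codewords and generic codes\<close>

definition zeros :: "nat \<Rightarrow> nat \<Rightarrow> (nat \<Rightarrow> nat \<Rightarrow> int) \<Rightarrow> int \<Rightarrow> (nat \<Rightarrow> int) \<Rightarrow> nat set"
  where "zeros r k G m w = {i \<in> {..<r}. m dvd (\<Sum>j<k. G i j * w j)}"

lemma finite_zeros [simp]: "finite (zeros r k G m w)"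
  by (simp add: zeros_def)

text \<open>The first condition is the MDS property: \<open>k\<close> zeros force the message to
  vanish modulo \<open>m\<close>. The second bounds the agreements of three words; since a common
  zero of \<open>u\<close> and \<open>v\<close> is one of \<open>u + v\<close>, the last
  intersection counts the positions where all three agree. Requiring fewer than \<open>k\<close>
  zeros excludes messages that vanish modulo \<open>m\<close>.\<close>

definition generic_code :: "nat \<Rightarrow> nat \<Rightarrow> (nat \<Rightarrow> nat \<Rightarrow> int) \<Rightarrow> int \<Rightarrow> bool"
  where "generic_code r k G m \<longleftrightarrow>
    (\<forall>u. k \<le> card (zeros r k G m u) \<longrightarrow> (\<forall>j<k. m dvd u j)) \<and>
    (\<forall>u v. card (zeros r k G m u) < k \<longrightarrow> card (zeros r k G m v) < k \<longrightarrow>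
      card (zeros r k G m (\<lambda>j. u j + v j)) < k \<longrightarrow>
      card (zeros r k G m u) + card (zeros r k G m v) + card (zeros r k G m (\<lambda>j. u j + v j))
        < 2 * k + card (zeros r k G m u \<inter> zeros r k G m v))"

text \<open>A violation of either condition yields enough zeros to select a nondegenerate system of
  \<open>2 * k\<close> constraints, which then forces the messages to vanish modulo
  \<open>m\<close>.\<close>

lemma exists_generic_code:
  assumes "k \<le> r"
  shows "\<exists>G D. D \<noteq> 0 \<and> (\<forall>m. coprime m D \<longrightarrow> generic_code r k G m)"
proof -
  define S :: "(nat \<times> int \<times> int) set" where "S = {..<r} \<times> {0, 1} \<times> {0, 1}"
  have "finite S" by (simp add: S_def)
  from exists_generic_matrix[OF this, of k]
  obtain G D where "D \<noteq> 0" and GD: "\<forall>L u v m. nondegenerate k L \<longrightarrow> set L \<subseteq> S \<longrightarrow>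
      coprime m D \<longrightarrow> (\<forall>(i, \<alpha>, \<beta>)\<in>set L. m dvd (\<Sum>j<k. G i j * (\<alpha> * u j + \<beta> * v j))) \<longrightarrow>
      (\<forall>j<k. m dvd u j \<and> m dvd v j)"
    by (elim exE conjE) (rule that)
  have key: "m dvd u j \<and> m dvd v j"
    if m: "coprime m D" and nd: "nondegenerate k (constraint_rows A B C)" and j: "j < k"
      and A: "A \<subseteq> zeros r k G m u" and B: "B \<subseteq> zeros r k G m v"
      and C: "C \<subseteq> zeros r k G m (\<lambda>j. u j + v j)" for m A B C u v j
  proof -
    have "finite A" "finite B" "finite C"
      using A B C by (auto intro: finite_subset[OF _ finite_zeros])
    note rows = set_constraint_rows[OF this]
    have "set (constraint_rows A B C) \<subseteq> S"
      unfolding rows S_def using A B C by (auto simp: zeros_def)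
    moreover have "\<forall>(i, \<alpha>, \<beta>)\<in>set (constraint_rows A B C).
        m dvd (\<Sum>j<k. G i j * (\<alpha> * u j + \<beta> * v j))"
      unfolding rows using A B C by (auto simp: zeros_def)
    ultimately show ?thesis
      using GD[THEN spec, THEN spec, THEN spec, THEN spec, THEN mp, THEN mp, THEN mp, THEN mp,
        OF nd _ m] j by blast
  qed
  \<comment> \<open>The pair \<open>(u, u)\<close> is used, with each of the \<open>k\<close> chosen
    positions serving once for either component.\<close>
  have mds: "\<forall>j<k. m dvd u j" if m: "coprime m D" and le: "k \<le> card (zeros r k G m u)" for m u
  proof -
    obtain K where K: "K \<subseteq> zeros r k G m u" "card K = k" "finite K"
      using obtain_subset_with_card_n[OF le] by metis
    then obtain \<phi> where "bij_betw \<phi> K {0..<k}"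
      using ex_bij_betw_finite_nat by metis
    then have "\<phi> ` K = {0..<k}" by (simp add: bij_betw_def)
    then have "nondegenerate k (constraint_rows K K {})"
      using K by (intro nondegenerate_constraint_rows[where \<phi> = \<phi>]) auto
    then show ?thesis using key[OF m, of K K "{}" _ u u] K(1) by auto
  qed
  have triple: "card (zeros r k G m u) + card (zeros r k G m v) + card (zeros r k G m (\<lambda>j. u j + v j))
        < 2 * k + card (zeros r k G m u \<inter> zeros r k G m v)"
    if m: "coprime m D" and lt: "card (zeros r k G m u) < k" "card (zeros r k G m v) < k"
      "card (zeros r k G m (\<lambda>j. u j + v j)) < k" for m u v
  proof (rule ccontr)
    define Zu Zv Zw where "Zu = zeros r k G m u" and "Zv = zeros r k G m v"
      and "Zw = zeros r k G m (\<lambda>j. u j + v j)"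
    define T where "T = Zu \<inter> Zv"
    assume "\<not> ?thesis"
    then have ge: "2 * k + card T \<le> card Zu + card Zv + card Zw"
      by (simp add: Zu_def Zv_def Zw_def T_def)
    have sum: "(\<Sum>j<k. G i j * (u j + v j)) = (\<Sum>j<k. G i j * u j) + (\<Sum>j<k. G i j * v j)" for i
      by (simp add: sum.distrib distrib_left)
    \<comment> \<open>Divisibility for two of \<open>u\<close>, \<open>v\<close>,
      \<open>u + v\<close> implies it for the third, so outside \<open>T\<close> the three zero sets
      are pairwise disjoint.\<close>
    have T: "Zu \<inter> Zw = T" "Zv \<inter> Zw = T"
      by (auto simp: T_def Zu_def Zv_def Zw_def zeros_def sum dvd_add_right_iff dvd_add_left_iff)
    have fin: "finite Zu" "finite Zv" "finite Zw" "finite T"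
      by (auto simp: Zu_def Zv_def Zw_def T_def)
    have sub: "T \<subseteq> Zu" "T \<subseteq> Zv" "T \<subseteq> Zw" using T by (auto simp: T_def)
    have le: "card T \<le> card Zu" "card T \<le> card Zv" "card T \<le> card Zw"
      using sub fin by (auto intro: card_mono)
    have diff: "card (Zu - T) = card Zu - card T" "card (Zv - T) = card Zv - card T"
        "card (Zw - T) = card Zw - card T"
      using sub fin by (auto intro: card_Diff_subset)
    define n where "n = k - card T"
    have lt': "card Zu < k" "card Zv < k" "card Zw < k"
      using lt by (simp_all add: Zu_def Zv_def Zw_def)
    \<comment> \<open>\<open>Zw\<close> is trimmed so that the total number of constraints is
      exactly \<open>2 * k\<close>. Points of \<open>T\<close> are left out of \<open>C\<close>
      since their third constraint follows from the other two.\<close>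
    obtain C where C: "C \<subseteq> Zw - T" "card C = 2 * n - card (Zu - T) - card (Zv - T)" "finite C"
      by (rule obtain_subset_with_card_n[of "2 * n - card (Zu - T) - card (Zv - T)" "Zw - T"])
        (use diff ge le in \<open>auto simp: n_def\<close>)
    have "\<exists>\<psi>. \<forall>s<n. s \<in> (\<psi> ` (Zu - T) \<inter> \<psi> ` (Zv - T)) \<union> (\<psi> ` (Zu - T) \<inter> \<psi> ` C) \<union> (\<psi> ` (Zv - T) \<inter> \<psi> ` C)"
    proof (rule cyclic_double_cover)
      have "card C \<le> card (Zw - T)" using C fin by (intro card_mono) auto
      then show "card C \<le> n" using diff lt' le by (simp add: n_def)
      show "card (Zu - T) + card (Zv - T) + card C = 2 * n"
        using C(2) diff lt' le ge by (auto simp: n_def)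
    qed (use fin C T diff lt' le in \<open>auto simp: n_def T_def\<close>)
    then obtain \<psi> where \<psi>: "\<forall>s<n. s \<in> (\<psi> ` (Zu - T) \<inter> \<psi> ` (Zv - T)) \<union> (\<psi> ` (Zu - T) \<inter> \<psi> ` C) \<union> (\<psi> ` (Zv - T) \<inter> \<psi> ` C)"
      by blast
    obtain \<tau> where "bij_betw \<tau> T {0..<card T}"
      using ex_bij_betw_finite_nat[OF fin(4)] by blast
    then have \<tau>: "\<tau> ` T = {0..<card T}" by (simp add: bij_betw_def)
    \<comment> \<open>The common zeros cover the first \<open>card T\<close> coordinates, twice
      through \<open>Zu\<close> and \<open>Zv\<close>; the cyclic cover handles the remaining
      \<open>n\<close> coordinates.\<close>
    define \<phi> where "\<phi> i = (if i \<in> T then \<tau> i else card T + \<psi> i)" for i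
    have \<phi>_T: "j \<in> \<phi> ` X" if "j < card T" "T \<subseteq> X" for j X
    proof -
      have "j \<in> \<tau> ` T" unfolding \<tau> using that(1) by simp
      then obtain i where "i \<in> T" "j = \<tau> i" by blast
      then show ?thesis using that(2) by (auto simp: \<phi>_def)
    qed
    have \<phi>_\<psi>: "card T + s \<in> \<phi> ` X" if s: "s \<in> \<psi> ` Y" and Y: "Y \<subseteq> X - T" for s X Y
    proof -
      obtain i where "i \<in> Y" "s = \<psi> i" using s by blast
      moreover from this have "i \<in> X" "i \<notin> T" using Y by auto
      ultimately show ?thesis by (auto simp: \<phi>_def)
    qed
    have "nondegenerate k (constraint_rows Zu Zv C)"
    proof (rule nondegenerate_constraint_rows[where \<phi> = \<phi>])
      show "card Zu + card Zv + card C = 2 * k"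
        using C(2) diff lt' le ge by (auto simp: n_def)
      fix j assume j: "j < k"
      show "j \<in> (\<phi> ` Zu \<inter> \<phi> ` Zv) \<union> (\<phi> ` Zu \<inter> \<phi> ` C) \<union> (\<phi> ` Zv \<inter> \<phi> ` C)"
      proof (cases "j < card T")
        case True
        then show ?thesis using \<phi>_T sub by blast
      next
        case False
        define s where "s = j - card T"
        have s: "s < n" "j = card T + s" using False j by (auto simp: s_def n_def)
        have "C \<subseteq> C - T" using C by blast
        then have "s \<in> \<psi> ` (Zu - T) \<longrightarrow> j \<in> \<phi> ` Zu" "s \<in> \<psi> ` (Zv - T) \<longrightarrow> j \<in> \<phi> ` Zv"
            "s \<in> \<psi> ` C \<longrightarrow> j \<in> \<phi> ` C"
          unfolding s(2) using \<phi>_\<psi>[of s] by simp_all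
        with \<psi>[rule_format, OF s(1)] show ?thesis by blast
      qed
    qed (use fin C in auto)
    then have "m dvd u j" if "j < k" for j
      using key[OF m _ that, of Zu Zv C u v] C by (auto simp: Zu_def Zv_def Zw_def)
    then have "Zu = {..<r}"
      by (auto simp: Zu_def zeros_def intro!: dvd_sum dvd_mult)
    then show False using lt'(1) assms by simp
  qed
  show ?thesis
    using \<open>D \<noteq> 0\<close> mds triple unfolding generic_code_def by blast
qed

section \<open>Strongly sparse hypergraphs\<close>

text \<open>For edges of size \<open>r\<close>, inclusion-exclusion turns the triple condition into
  a union of more than \<open>3 * r - 2 * k\<close> points. The pair condition is added so that
  sparsity survives unions of several families.\<close>

definition strongly_sparse :: "nat \<Rightarrow> 'a set set \<Rightarrow> bool"
  where "strongly_sparse k E \<longleftrightarrow>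
    (\<forall>a\<in>E. \<forall>b\<in>E. a \<noteq> b \<longrightarrow> card (a \<inter> b) < k) \<and>
    (\<forall>a\<in>E. \<forall>b\<in>E. \<forall>c\<in>E. a \<noteq> b \<longrightarrow> b \<noteq> c \<longrightarrow> a \<noteq> c \<longrightarrow>
      card (a \<inter> b) + card (b \<inter> c) + card (a \<inter> c) < 2 * k + card (a \<inter> b \<inter> c))"

lemma strongly_sparseD:
  assumes "strongly_sparse k E"
  shows "a \<in> E \<Longrightarrow> b \<in> E \<Longrightarrow> a \<noteq> b \<Longrightarrow> card (a \<inter> b) < k"
    and "a \<in> E \<Longrightarrow> b \<in> E \<Longrightarrow> c \<in> E \<Longrightarrow> a \<noteq> b \<Longrightarrow> b \<noteq> c \<Longrightarrow> a \<noteq> c \<Longrightarrow>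
      card (a \<inter> b) + card (b \<inter> c) + card (a \<inter> c) < 2 * k + card (a \<inter> b \<inter> c)"
  using assms by (simp_all add: strongly_sparse_def)

lemma card_Un3:
  assumes "finite a" "finite b" "finite c"
  shows "card (a \<union> b \<union> c) + card (a \<inter> b) + card (b \<inter> c) + card (a \<inter> c)
    = card a + card b + card c + card (a \<inter> b \<inter> c)"
proof -
  have "(a \<union> b) \<inter> c = (a \<inter> c) \<union> (b \<inter> c)" "(a \<inter> c) \<inter> (b \<inter> c) = a \<inter> b \<inter> c" by auto
  then show ?thesis
    using card_Un_Int[of a b] card_Un_Int[of "a \<union> b" c] card_Un_Int[of "a \<inter> c" "b \<inter> c"] assms
    by simp
qed

lemma strongly_sparse_imp_sparse_free:
  assumes E: "r_graph r V E" "strongly_sparse k E" and k: "k < r"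
  shows "sparse_free (3 * r - 2 * k) 3 E"
  unfolding sparse_free_def
proof
  fix F assume "F \<in> nsets E 3"
  then obtain a b c where F: "F = {a, b, c}" "a \<in> E" "b \<in> E" "c \<in> E" "a \<noteq> b" "b \<noteq> c" "a \<noteq> c"
    by (auto simp: nsets_3_eq)
  have edge: "finite e" "card e = r" if "e \<in> E" for e
    using that E(1) by (auto simp: r_graph_def nsets_def)
  have "card (a \<inter> b) + card (b \<inter> c) + card (a \<inter> c) < 2 * k + card (a \<inter> b \<inter> c)"
    by (rule strongly_sparseD(2)[OF E(2) F(2-7)])
  moreover have "\<Union>F = a \<union> b \<union> c" using F(1) by auto
  ultimately show "3 * r - 2 * k + 1 \<le> card (\<Union>F)"
    using card_Un3[of a b c] edge[OF F(2)] edge[OF F(3)] edge[OF F(4)] k by simp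
qed

text \<open>In a triple not contained in one class, at most one of the three pairs lies in one class.\<close>

lemma strongly_sparse_UN:
  assumes k: "2 \<le> k" and sparse: "\<And>i. i \<in> I \<Longrightarrow> strongly_sparse k (\<E> i)"
    and cross: "\<And>i j a b. i \<in> I \<Longrightarrow> j \<in> I \<Longrightarrow> i \<noteq> j \<Longrightarrow> a \<in> \<E> i \<Longrightarrow> b \<in> \<E> j \<Longrightarrow> card (a \<inter> b) \<le> 1"
  shows "strongly_sparse k (\<Union>i\<in>I. \<E> i)"
proof -
  have pair: "card (a \<inter> b) < k"
    if "i \<in> I" "j \<in> I" "a \<in> \<E> i" "b \<in> \<E> j" "a \<noteq> b" for i j a b
    using strongly_sparseD(1)[OF sparse[of i], of a b] cross[of i j a b] k that
    by (cases "i = j") auto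
  have triple: "card (a \<inter> b) + card (b \<inter> c) + card (a \<inter> c) < 2 * k + card (a \<inter> b \<inter> c)"
    if "i \<in> I" "j \<in> I" "l \<in> I" "a \<in> \<E> i" "b \<in> \<E> j" "c \<in> \<E> l" "a \<noteq> b" "b \<noteq> c" "a \<noteq> c"
    for i j l a b c
  proof (cases "i = j \<and> j = l")
    case True
    then show ?thesis
      using strongly_sparseD(2)[OF sparse[of i], of a b c] that by simp
  next
    case False
    have less: "card (a \<inter> b) < k" "card (b \<inter> c) < k" "card (a \<inter> c) < k"
      using pair that by blast+
    have le: "i \<noteq> j \<Longrightarrow> card (a \<inter> b) \<le> 1" "j \<noteq> l \<Longrightarrow> card (b \<inter> c) \<le> 1" "i \<noteq> l \<Longrightarrow> card (a \<inter> c) \<le> 1"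
      using cross that by blast+
    \<comment> \<open>Two of the three intersections have size at most 1 and the third at most
      \<open>k - 1\<close>; their sum \<open>k + 1\<close> is below \<open>2 * k\<close> because
      \<open>k\<close> is at least 2.\<close>
    from False consider "j \<noteq> l" "i \<noteq> l" | "i \<noteq> j" "i \<noteq> l" | "i \<noteq> j" "j \<noteq> l" by blast
    then show ?thesis
    proof cases
      case 1
      then show ?thesis using less(1) le(2,3) k by linarith
    next
      case 2
      then show ?thesis using less(2) le(1,3) k by linarith
    next
      case 3
      then show ?thesis using less(3) le(1,2) k by linarith
    qed
  qed
  show ?thesis
    unfolding strongly_sparse_def
  proof (intro conjI ballI impI; elim UN_E)
    fix a b i j assume "a \<noteq> b" "i \<in> I" "a \<in> \<E> i" "j \<in> I" "b \<in> \<E> j"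
    then show "card (a \<inter> b) < k" by (intro pair)
  next
    fix a b c i j l
    assume "a \<noteq> b" "b \<noteq> c" "a \<noteq> c" "i \<in> I" "a \<in> \<E> i" "j \<in> I" "b \<in> \<E> j" "l \<in> I" "c \<in> \<E> l"
    then show "card (a \<inter> b) + card (b \<inter> c) + card (a \<inter> c) < 2 * k + card (a \<inter> b \<inter> c)"
      by (intro triple)
  qed
qed

lemma strongly_sparse_image:
  assumes "inj f" and "strongly_sparse k E"
  shows "strongly_sparse k ((`) f ` E)"
proof -
  have card: "card (f ` a) = card a" for a
    using assms(1) by (meson card_image inj_on_subset subset_UNIV)
  have int: "f ` a \<inter> f ` b = f ` (a \<inter> b)" for a b
    using assms(1) by (simp add: image_Int)
  show ?thesis
    unfolding strongly_sparse_def
  proof (intro conjI ballI impI; elim imageE; hypsubst)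
    fix a b assume "f ` a \<noteq> f ` b" "a \<in> E" "b \<in> E"
    then show "card (f ` a \<inter> f ` b) < k"
      unfolding int card by (intro strongly_sparseD(1)[OF assms(2)]) auto
  next
    fix a b c assume "f ` a \<noteq> f ` b" "f ` b \<noteq> f ` c" "f ` a \<noteq> f ` c" "a \<in> E" "b \<in> E" "c \<in> E"
    then show "card (f ` a \<inter> f ` b) + card (f ` b \<inter> f ` c) + card (f ` a \<inter> f ` c)
        < 2 * k + card (f ` a \<inter> f ` b \<inter> f ` c)"
      unfolding int card by (intro strongly_sparseD(2)[OF assms(2)]) auto
  qed
qed

section \<open>The transversal code hypergraph and its recursive use\<close>

text \<open>Vertex \<open>i * m + a\<close> stands for the letter \<open>a\<close> at position
  \<open>i\<close>, and an edge is the graph of a codeword. Two edges then meet exactly in the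
  agreements of their words, so \<open>generic_code\<close> translates into strong sparsity.\<close>

lemma block_code_graph:
  assumes code: "generic_code r k G (int m)" and m: "0 < m" and k: "k < r"
  shows "\<exists>E. r_graph r {..<r * m} E \<and> strongly_sparse k E \<and> card E = m ^ k \<and>
    (\<forall>e\<in>E. \<forall>i. card (e \<inter> {i * m..<Suc i * m}) \<le> 1)"
proof -
  define word where "word x i = nat ((\<Sum>j<k. G i j * x j) mod int m)" for x i
  define edge where "edge x = {p. p div m < r \<and> p mod m = word x (p div m)}" for x
  \<comment> \<open>One representative per residue class in each coordinate: messages in
    \<open>X\<close> that are congruent modulo \<open>m\<close> are equal.\<close>
  define X where "X = PiE {..<k} (\<lambda>_. {0..<int m})"
  define Z where "Z x y = zeros r k G (int m) (\<lambda>j. x j - y j)" for x y :: "nat \<Rightarrow> int"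
  have word_less: "word x i < m" for x i
    using m by (simp add: word_def nat_less_iff)
  have word_eq: "word x i = word y i \<longleftrightarrow> int m dvd (\<Sum>j<k. G i j * (x j - y j))" for x y i
  proof -
    have "word x i = word y i \<longleftrightarrow> (\<Sum>j<k. G i j * x j) mod int m = (\<Sum>j<k. G i j * y j) mod int m"
      using m by (simp add: word_def eq_nat_nat_iff)
    then show ?thesis
      by (simp add: mod_eq_dvd_iff right_diff_distrib sum_subtractf)
  qed
  \<comment> \<open>An edge has one vertex in each block, so passing to block indices turns
    intersections of edges into sets of positions of equal size.\<close>
  have inj: "inj_on (\<lambda>p. p div m) (edge x)" for x
    by (rule inj_onI) (metis (mono_tags, lifting) edge_def div_mult_mod_eq mem_Collect_eq)
  have point: "i * m + word x i \<in> edge x" "(i * m + word x i) div m = i" if "i < r" for x i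
    using that word_less[of x i] m by (auto simp: edge_def)
  have image_edge: "(\<lambda>p. p div m) ` edge x = {..<r}" for x
  proof
    show "{..<r} \<subseteq> (\<lambda>p. p div m) ` edge x"
      using point by (metis image_eqI lessThan_iff subsetI)
  qed (auto simp: edge_def)
  have image_inter: "(\<lambda>p. p div m) ` (edge x \<inter> S) = {i. i < r \<and> i * m + word x i \<in> S}" for x S
  proof (intro equalityI subsetI)
    fix i assume "i \<in> (\<lambda>p. p div m) ` (edge x \<inter> S)"
    then obtain p where "p \<in> edge x" "p \<in> S" "i = p div m" by blast
    moreover from this have "i * m + word x i = p"
      by (simp add: edge_def) (metis div_mult_mod_eq)
    ultimately show "i \<in> {i. i < r \<and> i * m + word x i \<in> S}" by (simp add: edge_def)
  next
    fix i assume "i \<in> {i. i < r \<and> i * m + word x i \<in> S}"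
    then show "i \<in> (\<lambda>p. p div m) ` (edge x \<inter> S)"
      using point[of i x] by (intro image_eqI[of _ _ "i * m + word x i"]) auto
  qed
  have card_inter: "card (edge x \<inter> S) = card {i. i < r \<and> i * m + word x i \<in> S}" for x S
    unfolding image_inter[symmetric]
    by (intro card_image[symmetric] inj_on_subset[OF inj]) auto
  have mem_edge: "i * m + word x i \<in> edge y \<longleftrightarrow> i \<in> Z x y" if "i < r" for x y i
    using that word_less[of x i] word_eq[of x i y]
    by (simp add: edge_def Z_def zeros_def)
  have card_edge: "card (edge x) = r" for x
    using card_image[OF inj[of x]] image_edge[of x] by simp
  have Z_less: "i \<in> Z x y \<Longrightarrow> i < r" for i x y by (simp add: Z_def zeros_def)
  have card2: "card (edge x \<inter> edge y) = card (Z x y)" for x y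
  proof -
    have "{i. i < r \<and> i * m + word x i \<in> edge y} = Z x y"
      using mem_edge Z_less by blast
    then show ?thesis unfolding card_inter by simp
  qed
  have card3: "card (edge x \<inter> edge y \<inter> edge z) = card (Z x y \<inter> Z x z)" for x y z
  proof -
    have "{i. i < r \<and> i * m + word x i \<in> edge y \<inter> edge z} = Z x y \<inter> Z x z"
      using mem_edge Z_less by blast
    then show ?thesis unfolding Int_assoc card_inter by simp
  qed
  have less: "card (Z x y) < k" if "x \<in> X" "y \<in> X" "x \<noteq> y" for x y
  proof (rule ccontr)
    assume "\<not> card (Z x y) < k"
    then have dvd: "int m dvd x j - y j" if "j < k" for j
      using code[unfolded generic_code_def, THEN conjunct1, rule_format, of "\<lambda>j. x j - y j" j]
        that unfolding Z_def by (simp add: not_less)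
    have "x j = y j" if "j \<in> {..<k}" for j
    proof -
      have "x j mod int m = y j mod int m"
        using dvd[of j] that by (simp add: mod_eq_dvd_iff)
      moreover have "x j \<in> {0..<int m}" "y j \<in> {0..<int m}"
        using PiE_mem[OF \<open>x \<in> X\<close>[unfolded X_def] that] PiE_mem[OF \<open>y \<in> X\<close>[unfolded X_def] that] by auto
      ultimately show ?thesis by simp
    qed
    then have "x = y"
      using that(1,2) unfolding X_def by (intro PiE_ext) auto
    with that(3) show False ..
  qed
  have sum: "card (Z x y) + card (Z y z) + card (Z x z) < 2 * k + card (Z x y \<inter> Z x z)"
    if "x \<in> X" "y \<in> X" "z \<in> X" "x \<noteq> y" "y \<noteq> z" "x \<noteq> z" for x y z
  proof -
    \<comment> \<open>Telescoping \<open>x - z = (x - y) + (y - z)\<close> matches the shape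
      \<open>u\<close>, \<open>v\<close>, \<open>u + v\<close> of
      \<open>generic_code\<close>.\<close>
    have "Z x z = zeros r k G (int m) (\<lambda>j. (x j - y j) + (y j - z j))" by (simp add: Z_def)
    moreover have "Z x y \<inter> Z x z = Z x y \<inter> Z y z"
    proof -
      have "i \<in> Z a b \<longleftrightarrow> i < r \<and> word a i = word b i" for a b i
        unfolding word_eq by (simp add: Z_def zeros_def)
      then show ?thesis by auto
    qed
    ultimately show ?thesis
      using code[unfolded generic_code_def, THEN conjunct2, rule_format,
          of "\<lambda>j. x j - y j" "\<lambda>j. y j - z j", folded Z_def] less that by (simp add: Z_def)
  qed
  define E where "E = edge ` X"
  have "inj_on edge X"
  proof (rule inj_onI, rule ccontr)
    fix x y assume xy: "x \<in> X" "y \<in> X" "edge x = edge y" "x \<noteq> y"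
    then show False using less[OF xy(1,2,4)] card2[of x y] card_edge[of x] k by simp
  qed
  then have "card E = m ^ k"
    by (simp add: E_def card_image X_def card_PiE)
  moreover have "r_graph r {..<r * m} E"
  proof -
    have "edge x \<subseteq> {..<r * m}" for x
      using m by (auto simp: edge_def div_less_iff_less_mult)
    then show ?thesis
      using card_edge by (auto simp: r_graph_def nsets_def E_def intro: finite_subset)
  qed
  moreover have "strongly_sparse k E"
    unfolding strongly_sparse_def E_def
  proof (intro conjI ballI impI; elim imageE; hypsubst)
    fix x y assume "edge x \<noteq> edge y" "x \<in> X" "y \<in> X"
    then show "card (edge x \<inter> edge y) < k"
      unfolding card2 by (intro less) auto
  next
    fix x y z
    assume "edge x \<noteq> edge y" "edge y \<noteq> edge z" "edge x \<noteq> edge z" "x \<in> X" "y \<in> X" "z \<in> X"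
    then show "card (edge x \<inter> edge y) + card (edge y \<inter> edge z) + card (edge x \<inter> edge z)
        < 2 * k + card (edge x \<inter> edge y \<inter> edge z)"
      unfolding card2 card3 by (intro sum) auto
  qed
  moreover have "card (e \<inter> {i * m..<Suc i * m}) \<le> 1" if e_in: "e \<in> E" for e i
  proof -
    obtain x where e: "e = edge x" using e_in by (auto simp: E_def)
    have "{l. l < r \<and> l * m + word x l \<in> {i * m..<Suc i * m}} \<subseteq> {i}"
    proof clarsimp
      fix l assume "i * m \<le> l * m + word x l" "l * m + word x l < m + i * m"
      then have "(l * m + word x l) div m = i"
        by (intro div_nat_eqI) (auto simp: algebra_simps)
      then show "l = i" using word_less[of x l] m by simp
    qed
    then show ?thesis
      unfolding e card_inter by (metis card.empty card_insert_disjoint card_mono empty_iff finite.emptyI finite.insertI One_nat_def)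
  qed
  ultimately show ?thesis by blast
qed

text \<open>Each copy of \<open>F\<close> stays inside one block, the blocks are disjoint, and a
  transversal edge meets a block at most once. Edges of different families thus share at most one
  vertex, which is what \<open>strongly_sparse_UN\<close> asks for.\<close>

lemma recursive_construction:
  assumes k: "2 \<le> k" "k < r" and m: "0 < m" and code: "generic_code r k G (int m)"
    and F: "r_graph r {..<m} F" "strongly_sparse k F"
  shows "\<exists>E. r_graph r {..<r * m} E \<and> strongly_sparse k E \<and> card E = m ^ k + r * card F"
proof -
  obtain T where T: "r_graph r {..<r * m} T" "strongly_sparse k T" "card T = m ^ k"
    and T1: "\<And>e i. e \<in> T \<Longrightarrow> card (e \<inter> {i * m..<Suc i * m}) \<le> 1"
    using block_code_graph[OF code m k(2)] by blast
  define P where "P i = {i * m..<Suc i * m}" for i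
  define copy where "copy i = (`) (\<lambda>p. i * m + p) ` F" for i
  \<comment> \<open>Indices below \<open>r\<close> denote the copies in the blocks; index
    \<open>r\<close> denotes the transversal family.\<close>
  define \<E> where "\<E> i = (if i < r then copy i else T)" for i
  have F_edge: "e \<subseteq> {..<m}" "finite e" "card e = r" if "e \<in> F" for e
    using that F(1) by (auto simp: r_graph_def nsets_def)
  have copy_sub: "e \<subseteq> P i" "card e = r" "finite e" if e: "e \<in> copy i" for e i
  proof -
    obtain f where "f \<in> F" "e = (\<lambda>p. i * m + p) ` f" using e by (auto simp: copy_def)
    then show "e \<subseteq> P i" "card e = r" "finite e"
      using F_edge[of f] by (auto simp: P_def card_image)
  qed
  have P_sub: "P i \<subseteq> {..<r * m}" if "i < r" for i
  proof -
    have "Suc i * m \<le> r * m" using that by (intro mult_le_mono1) simp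
    then show ?thesis by (auto simp: P_def)
  qed
  have P_disj: "P i \<inter> P j = {}" if ij: "i \<noteq> j" for i j
  proof -
    have "p div m = i" if "p \<in> P i" for p i
      using that m by (intro div_nat_eqI) (auto simp: P_def algebra_simps)
    then show ?thesis using ij by blast
  qed
  have graph: "r_graph r {..<r * m} (\<E> i)" if "i \<le> r" for i
    using that T(1) copy_sub P_sub[of i] unfolding \<E>_def r_graph_def nsets_def
    by (cases "i < r") fastforce+
  have sparse: "strongly_sparse k (\<E> i)" for i
    using T(2) F(2) unfolding \<E>_def copy_def by (auto intro!: strongly_sparse_image injI)
  have cross': "card (a \<inter> b) \<le> 1" if "i < j" "j \<le> r" "a \<in> \<E> i" "b \<in> \<E> j" for i j a b
  proof -
    have a: "a \<in> copy i" using that by (simp add: \<E>_def)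
    show ?thesis
    proof (cases "j < r")
      case True
      then have "a \<inter> b = {}"
        using copy_sub(1)[OF a] copy_sub(1)[of b j] P_disj[of i j] that by (auto simp: \<E>_def)
      then show ?thesis by simp
    next
      case False
      then have b: "b \<in> T" using that by (simp add: \<E>_def)
      have "a \<inter> b \<subseteq> b \<inter> P i" using copy_sub(1)[OF a] by blast
      then have "card (a \<inter> b) \<le> card (b \<inter> P i)" by (intro card_mono) (auto simp: P_def)
      then show ?thesis using T1[OF b, of i] by (simp add: P_def)
    qed
  qed
  have cross: "card (a \<inter> b) \<le> 1"
    if "i \<in> {..r}" "j \<in> {..r}" "i \<noteq> j" "a \<in> \<E> i" "b \<in> \<E> j" for i j a b
    using cross'[of i j a b] cross'[of j i b a] that by (cases "i < j") (auto simp: Int_commute)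
  define E where "E = (\<Union>i\<in>{..r}. \<E> i)"
  have "strongly_sparse k E"
    unfolding E_def using k(1) sparse cross by (rule strongly_sparse_UN)
  moreover have E_graph: "r_graph r {..<r * m} E"
    using graph unfolding E_def r_graph_def by blast
  moreover have "card E = m ^ k + r * card F"
  proof -
    have fin: "finite (\<E> i)" if "i \<le> r" for i
      using graph[OF that] unfolding r_graph_def
      by (meson finite_imp_finite_nsets finite_lessThan finite_subset)
    \<comment> \<open>A common edge would meet itself in \<open>r > 1\<close> vertices.\<close>
    have disj: "\<E> i \<inter> \<E> j = {}" if ij: "i \<le> r" "j \<le> r" "i \<noteq> j" for i j
    proof (rule ccontr)
      assume "\<E> i \<inter> \<E> j \<noteq> {}"
      then obtain e where e: "e \<in> \<E> i" "e \<in> \<E> j" by blast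
      then have "card e = r" using graph[OF ij(1)] by (auto simp: r_graph_def nsets_def)
      then show False using cross[of i j e e] e ij k by auto
    qed
    have "card E = (\<Sum>i\<in>{..r}. card (\<E> i))"
      unfolding E_def using fin disj by (intro card_UN_disjoint) auto
    also have "\<dots> = (\<Sum>i<r. card (\<E> i)) + card (\<E> r)"
      by (simp add: lessThan_Suc_atMost[symmetric])
    also have "(\<Sum>i<r. card (\<E> i)) = (\<Sum>i<r. card F)"
    proof (intro sum.cong refl)
      fix i assume "i \<in> {..<r}"
      moreover have "inj ((`) (\<lambda>p. i * m + p))"
        by (rule injI) (simp add: inj_image_eq_iff inj_on_def)
      ultimately show "card (\<E> i) = card F"
        by (simp add: \<E>_def copy_def card_image inj_on_subset)
    qed
    finally show ?thesis by (simp add: \<E>_def T(3))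
  qed
  ultimately show ?thesis by blast
qed

section \<open>Asymptotic density\<close>

lemma max_edges_ge:
  assumes "r_graph r {..<n} E" "sparse_free v e E"
  shows "card E \<le> max_edges r n v e"
  unfolding max_edges_def
proof (rule Max_ge)
  have "{card E |E. r_graph r {..<n} E \<and> sparse_free v e E} \<subseteq> card ` Pow (nsets {..<n} r)"
    by (auto simp: r_graph_def)
  then show "finite {card E |E. r_graph r {..<n} E \<and> sparse_free v e E}"
    by (rule finite_subset) (simp add: finite_imp_finite_nsets)
qed (use assms in blast)

lemma max_edges_attained:
  assumes "0 < e"
  shows "\<exists>E. r_graph r {..<n} E \<and> sparse_free v e E \<and> card E = max_edges r n v e"
proof -
  let ?S = "{card E |E. r_graph r {..<n} E \<and> sparse_free v e E}"
  have "?S \<subseteq> card ` Pow (nsets {..<n} r)"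
    by (auto simp: r_graph_def)
  then have "finite ?S"
    by (rule finite_subset) (simp add: finite_imp_finite_nsets)
  moreover have "r_graph r {..<n} {}" "sparse_free v e ({} :: nat set set)"
    using assms by (auto simp: r_graph_def sparse_free_def nsets_def)
  then have "?S \<noteq> {}" by blast
  ultimately have "max_edges r n v e \<in> ?S"
    unfolding max_edges_def by (rule Max_in)
  then show ?thesis by auto
qed

definition dense_family :: "nat \<Rightarrow> nat \<Rightarrow> real \<Rightarrow> bool"
  where "dense_family r k a \<longleftrightarrow> (\<forall>\<^sub>F n in sequentially.
    \<exists>E. r_graph r {..<n} E \<and> strongly_sparse k E \<and> a * real n ^ k \<le> real (card E))"

text \<open>With \<open>m\<close> close to \<open>n / r\<close>, the construction gives about
  \<open>(1 + r * a) * m ^ k\<close> edges. The bounded gap between \<open>m\<close> and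
  \<open>n / r\<close> changes only lower-order terms, absorbed by the strict inequality for
  \<open>b\<close>.\<close>

lemma dense_family_step:
  assumes k: "2 \<le> k" "k < r" and D: "D \<noteq> 0" and code: "\<And>m. coprime m D \<Longrightarrow> generic_code r k G m"
    and a: "0 \<le> a" "dense_family r k a" and b: "b < (1 + real r * a) / real r ^ k"
  shows "dense_family r k b"
proof -
  define d where "d = nat \<bar>D\<bar>"
  have d: "0 < d" "\<bar>D\<bar> = int d" using D by (simp_all add: d_def)
  \<comment> \<open>For \<open>r \<le> n\<close> this is the largest number up to
    \<open>n div r\<close> that is congruent to 1 modulo \<open>d\<close>, and hence coprime to
    \<open>D\<close>.\<close>
  define m where "m n = d * ((n div r - 1) div d) + 1" for n
  have coprime: "generic_code r k G (int (m n))" for n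
  proof (rule code)
    have "coprime (int (m n)) (int d)"
      by (simp add: m_def) (metis coprime_commute coprime_mult_left_iff coprime_add_one_right
          dvd_triv_left coprime_divisors dvd_refl add.commute)
    then show "coprime (int (m n)) D"
      using d(2) by (metis coprime_abs_right_iff)
  qed
  have m_le: "r * m n \<le> n" if "r \<le> n" for n
  proof -
    have "1 \<le> n div r" using that k by (simp add: Suc_le_eq div_greater_zero_iff)
    moreover have "d * ((n div r - 1) div d) \<le> n div r - 1" by simp
    ultimately have "m n \<le> n div r" unfolding m_def by linarith
    then have "r * m n \<le> r * (n div r)" by simp
    also have "\<dots> \<le> n" by simp
    finally show ?thesis .
  qed
  have m_ge: "real n / real r - (1 + real d) \<le> real (m n)" for n
  proof -
    have "n div r - 1 < d * ((n div r - 1) div d) + d"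
      using dividend_less_times_div[OF d(1), of "n div r - 1"] by simp
    then have "n div r \<le> m n + d" by (simp add: m_def)
    then have "real (n div r) \<le> real (m n + d)" by (simp only: of_nat_le_iff)
    moreover have "real n / real r \<le> real (n div r) + 1"
    proof -
      have "n \<le> r * (n div r + 1)"
        using dividend_less_times_div[of r n] k by simp
      then have "real n \<le> real (r * (n div r + 1))" by (simp only: of_nat_le_iff)
      then show ?thesis using k by (simp add: field_simps)
    qed
    ultimately show ?thesis by simp
  qed
  obtain N where N: "\<And>n. N \<le> n \<Longrightarrow>
      \<exists>E. r_graph r {..<n} E \<and> strongly_sparse k E \<and> a * real n ^ k \<le> real (card E)"
    using a(2) unfolding dense_family_def eventually_sequentially by blast
  have "(\<lambda>n. (1 / real r - (1 + real d) / real n) ^ k * (1 + real r * a))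
      \<longlonglongrightarrow> (1 / real r - 0) ^ k * (1 + real r * a)"
    by (intro tendsto_intros lim_const_over_n)
  then have lim: "\<forall>\<^sub>F n in sequentially.
      b < (1 / real r - (1 + real d) / real n) ^ k * (1 + real r * a)"
    by (rule order_tendstoD(1)) (use b in \<open>simp add: power_divide\<close>)
  show ?thesis
    unfolding dense_family_def
    \<comment> \<open>The threshold ensures that \<open>m n\<close> is at least \<open>N\<close>, so
      that a dense \<open>F\<close> on \<open>m n\<close> vertices is available.\<close>
    using lim eventually_ge_at_top[of "r * (N + 2 + d)"]
  proof eventually_elim
    case (elim n)
    define x where "x = real n / real r - (1 + real d)"
    have r0: "0 < r" using k by simp
    have n0: "0 < n" "r \<le> n" using elim(2) r0 by (auto intro: order_trans[OF _ elim(2)] less_le_trans[OF _ elim(2)])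
    have "real (r * (N + 2 + d)) \<le> real n" using elim(2) by (simp only: of_nat_le_iff)
    then have "real N + 1 \<le> x"
      using r0 by (simp add: x_def field_simps)
    then have x: "real N \<le> x" "0 \<le> x" by linarith+
    have "real N \<le> real (m n)" using x(1) m_ge[of n] by (simp add: x_def)
    then obtain F where F: "r_graph r {..<m n} F" "strongly_sparse k F"
        "a * real (m n) ^ k \<le> real (card F)"
      using N[of "m n"] by auto
    obtain E where E: "r_graph r {..<r * m n} E" "strongly_sparse k E"
        "card E = m n ^ k + r * card F"
      using recursive_construction[OF k _ coprime F(1,2)] by (auto simp: m_def)
    have "b * real n ^ k \<le> (1 / real r - (1 + real d) / real n) ^ k * (1 + real r * a) * real n ^ k"
      using elim(1) by (intro mult_right_mono) auto
    also have "\<dots> = ((1 / real r - (1 + real d) / real n) * real n) ^ k * (1 + real r * a)"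
      by (simp add: power_mult_distrib)
    also have "(1 / real r - (1 + real d) / real n) * real n = x"
      using n0 by (simp add: x_def left_diff_distrib)
    also have "x ^ k * (1 + real r * a) \<le> real (m n) ^ k * (1 + real r * a)"
      using x(2) m_ge[of n] a(1) by (intro mult_right_mono power_mono) (auto simp: x_def)
    also have "\<dots> = real (m n) ^ k + real r * (a * real (m n) ^ k)"
      by (simp add: algebra_simps)
    also have "\<dots> \<le> real (card E)"
      unfolding E(3) using F(3) by (simp add: mult_left_mono)
    finally have "b * real n ^ k \<le> real (card E)" .
    moreover have "r_graph r {..<n} E"
      using E(1) m_le[OF n0(2)] nsets_mono[of "{..<r * m n}" "{..<n}" r]
      by (auto simp: r_graph_def)
    ultimately show ?case using E(2) by blast
  qed
qed

text \<open>The map sending \<open>a\<close> to \<open>(1 + r * a) / r ^ k\<close> has the fixed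
  point \<open>1 / (r ^ k - r)\<close>. Up to a value \<open>b\<close> below it, each step gains at
  least a fixed amount, so finitely many steps from density 0 reach \<open>b\<close>.\<close>

lemma dense_family_below_limit:
  assumes k: "2 \<le> k" "k < r" and b: "0 \<le> b" "b < 1 / (real r ^ k - real r)"
  shows "dense_family r k b"
proof -
  obtain G D where D: "D \<noteq> 0" and code: "\<And>m. coprime m D \<Longrightarrow> generic_code r k G m"
    using exists_generic_code[of k r] k by auto
  have "real r ^ 1 < real r ^ k"
    using k by (intro power_strict_increasing) auto
  then have pos: "0 < real r ^ k - real r" by simp
  \<comment> \<open>Half of the gain at \<open>a = b\<close>, where the gain is smallest; halving
    leaves the strict inequality that \<open>dense_family_step\<close> demands.\<close>
  define \<delta> where "\<delta> = (1 - b * (real r ^ k - real r)) / (2 * real r ^ k)"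
  have rk: "0 < real r ^ k" using k by simp
  have "0 < 1 - b * (real r ^ k - real r)" using b(2) pos by (simp add: field_simps)
  then have \<delta>: "0 < \<delta>" using rk by (simp add: \<delta>_def)
  have gain: "a + \<delta> < (1 + real r * a) / real r ^ k" if "a \<le> b" for a
  proof -
    have "a * (real r ^ k - real r) \<le> b * (real r ^ k - real r)"
      using that pos by (intro mult_right_mono) auto
    then have "2 * \<delta> * real r ^ k \<le> 1 - a * (real r ^ k - real r)"
      using rk by (simp add: \<delta>_def)
    moreover have "0 < \<delta> * real r ^ k" using \<delta> rk by simp
    ultimately have "(a + \<delta>) * real r ^ k < 1 + real r * a"
      by (simp add: algebra_simps)
    then show ?thesis using rk by (simp add: less_divide_eq)
  qed
  have "dense_family r k (min b (real s * \<delta>))" for s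
  proof (induction s)
    case 0
    have "r_graph r {..<n} {} \<and> strongly_sparse k {} \<and> 0 * real n ^ k \<le> real (card {})" for n
      by (simp add: r_graph_def strongly_sparse_def)
    then have "dense_family r k 0"
      unfolding dense_family_def by (intro always_eventually allI exI)
    then show ?case using b by simp
  next
    case (Suc s)
    have "min b (real (Suc s) * \<delta>) \<le> min b (real s * \<delta>) + \<delta>"
      using \<delta> by (simp add: min_def algebra_simps)
    also have "\<dots> < (1 + real r * min b (real s * \<delta>)) / real r ^ k"
      by (rule gain) simp
    finally show ?case
      using dense_family_step[OF k D code _ Suc] b(1) \<delta> by simp
  qed
  moreover obtain s :: nat where "b < real s * \<delta>"
    using reals_Archimedean3[OF \<delta>] by blast
  ultimately show ?thesis by (metis min.strict_order_iff)
qed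

section \<open>Passage to the limit inferior and superior\<close>

lemma liminf_lower_bound:
  assumes k: "2 \<le> k" "k < r"
  shows "ereal (1 / (real r ^ k - real r))
    \<le> liminf (\<lambda>n. ereal (real (max_edges r n (3 * r - 2 * k) 3) / real n ^ k))"
  unfolding le_Liminf_iff
proof (intro allI impI)
  fix y assume y: "y < ereal (1 / (real r ^ k - real r))"
  have "real r ^ 1 < real r ^ k"
    using k by (intro power_strict_increasing) auto
  then have "ereal 0 < ereal (1 / (real r ^ k - real r))" by simp
  \<comment> \<open>\<open>y\<close> may be negative or minus infinity; the maximum with 0 yields a
    nonnegative real density \<open>b\<close> above \<open>y\<close>.\<close>
  with y have "max y 0 < ereal (1 / (real r ^ k - real r))" by (simp add: zero_ereal_def)
  then obtain b where b: "max y 0 < ereal b" "ereal b < ereal (1 / (real r ^ k - real r))"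
    using ereal_dense2 by blast
  then have "0 \<le> b" "b < 1 / (real r ^ k - real r)" by (simp_all add: zero_ereal_def)
  then have "dense_family r k b" using k by (intro dense_family_below_limit)
  then show "\<forall>\<^sub>F n in sequentially. y < ereal (real (max_edges r n (3 * r - 2 * k) 3) / real n ^ k)"
    unfolding dense_family_def using eventually_gt_at_top[of 0]
  proof eventually_elim
    case (elim n)
    then obtain E where E: "r_graph r {..<n} E" "strongly_sparse k E" "b * real n ^ k \<le> real (card E)"
      by blast
    have "card E \<le> max_edges r n (3 * r - 2 * k) 3"
      using E strongly_sparse_imp_sparse_free k by (intro max_edges_ge) auto
    then have "b * real n ^ k \<le> real (max_edges r n (3 * r - 2 * k) 3)"
      using E(3) by linarith
    then have "b \<le> real (max_edges r n (3 * r - 2 * k) 3) / real n ^ k"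
      using elim(2) by (simp add: pos_le_divide_eq)
    moreover have "y < ereal b" using b(1) by simp
    ultimately show ?case by (metis ereal_less_eq(3) less_le_trans)
  qed
qed

lemma limsup_upper_bound:
  assumes k: "1 \<le> k" "k < r"
  shows "limsup (\<lambda>n. ereal (real (max_edges r n (3 * r - 2 * k) 3) / real n ^ k))
    \<le> ereal (1 / (fact k * real (r choose k) - fact k / 2))"
proof -
  define c where "c = real (r choose k) - 1 / 2"
  have "1 \<le> r choose k" using k by (simp add: Suc_leI)
  then have c: "0 < c" unfolding c_def by linarith
  have denom: "fact k * real (r choose k) - fact k / 2 = fact k * c"
    by (simp add: c_def algebra_simps)
  \<comment> \<open>The main term comes from \<open>n choose k\<close> being at most
    \<open>n ^ k / fact k\<close>, the error \<open>2 / n\<close> from the at most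
    \<open>2 * n ^ (k - 1)\<close> deleted edges.\<close>
  have "real (max_edges r n (3 * r - 2 * k) 3) / real n ^ k \<le> 1 / (fact k * c) + 2 / real n"
    if n: "0 < n" for n
  proof -
    obtain E where E: "r_graph r {..<n} E" "sparse_free (3 * r - 2 * k) 3 E"
        "card E = max_edges r n (3 * r - 2 * k) 3"
      using max_edges_attained[of 3 r n "3 * r - 2 * k"] by auto
    have "c * (real (card E) - 2 * real (n choose (k - 1))) \<le> real (n choose k)"
      using card_sparse_free_le[OF _ E(1,2) k] by (simp add: c_def)
    then have "real (card E) \<le> real (n choose k) / c + 2 * real (n choose (k - 1))"
      using c by (simp add: field_simps)
    moreover have "real (n choose k) \<le> real n ^ k / fact k"
    proof -
      have "real ((n choose k) * fact k) \<le> real (n ^ k)"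
        using binomial_fact_pow[of n k] by (simp only: of_nat_le_iff)
      then show ?thesis by (simp add: field_simps)
    qed
    then have "real (n choose k) / c \<le> real n ^ k / fact k / c"
      using c by (intro divide_right_mono) auto
    moreover have "real (n choose (k - 1)) \<le> real n ^ (k - 1)"
    proof -
      have "(n choose (k - 1)) * 1 \<le> (n choose (k - 1)) * fact (k - 1)"
        by (intro mult_le_mono2 fact_ge_1)
      then have "n choose (k - 1) \<le> n ^ (k - 1)"
        using binomial_fact_pow[of n "k - 1"] by linarith
      then have "real (n choose (k - 1)) \<le> real (n ^ (k - 1))" by (simp only: of_nat_le_iff)
      then show ?thesis by simp
    qed
    ultimately have "real (card E) \<le> real n ^ k / fact k / c + 2 * real n ^ (k - 1)"
      by linarith
    also have "\<dots> = (1 / (fact k * c) + 2 / real n) * real n ^ k"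
      using n k by (simp add: distrib_right power_diff)
    finally show ?thesis
      using n unfolding E(3) by (simp add: pos_divide_le_eq)
  qed
  then have "limsup (\<lambda>n. ereal (real (max_edges r n (3 * r - 2 * k) 3) / real n ^ k))
      \<le> limsup (\<lambda>n. ereal (1 / (fact k * c) + 2 / real n))"
    by (intro Limsup_mono eventually_mono[OF eventually_gt_at_top[of 0]]) simp
  also have "\<dots> = ereal (1 / (fact k * c))"
  proof (rule lim_imp_Limsup)
    have "(\<lambda>n. 1 / (fact k * c) + 2 / real n) \<longlonglongrightarrow> 1 / (fact k * c) + 0"
      by (intro tendsto_add tendsto_const lim_const_over_n)
    then show "(\<lambda>n. ereal (1 / (fact k * c) + 2 / real n)) \<longlonglongrightarrow> ereal (1 / (fact k * c))"
      by simp
  qed simp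
  finally show ?thesis unfolding denom .
qed

theorem theorem6:
  fixes r k :: nat
  assumes "2 \<le> k" and "k < r"
  shows "ereal (1 / (real r ^ k - real r))
           \<le> liminf (\<lambda>n. ereal (real (max_edges r n (3 * r - 2 * k) 3) / real n ^ k))
       \<and> liminf (\<lambda>n. ereal (real (max_edges r n (3 * r - 2 * k) 3) / real n ^ k))
           \<le> limsup (\<lambda>n. ereal (real (max_edges r n (3 * r - 2 * k) 3) / real n ^ k))
       \<and> limsup (\<lambda>n. ereal (real (max_edges r n (3 * r - 2 * k) 3) / real n ^ k))
           \<le> ereal (1 / (fact k * real (r choose k) - fact k / 2))"
  using assms by (intro conjI liminf_lower_bound limsup_upper_bound Liminf_le_Limsup) simp_all

end
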